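(* Let $E$ and $F$ be proper BSFs on some set $X$ such that $E\subset F$ with continuous inclusion map $\mathrm{id}:E\to F$. Then this inclusion map is 2-factorable if and only if there exists an RKHS $H$ over $X$ such that $$E\subset H\subset F.$$ In this case we also have $E\hookrightarrow H\hookrightarrow F$, that is, the inclusion maps $E\to H$ and $H\to F$ are continuous.
   Context: Let $X\neq\emptyset$ be a set. A Banach space of functions (BSF) on $X$ is a Banach space whose elements are functions $X\to\mathbb{R}$ (with pointwise vector space operations). A BSF $E$ on $X$ is proper if for every $x\in X$ the evaluation functional $\delta_x:E\to\mathbb{R}$, $f\mapsto f(x)$, is continuous. A reproducing kernel Hilbert space (RKHS) on (over) $X$ is a proper BSF on $X$ whose norm is a Hilbert space norm. Inclusions such as $E\subset H$ are inclusions of sets of functions; $E\hookrightarrow H$ means that $E\subset H$ and the inclusion map is continuous. A bounded linear operator $A:E\to F$ between Banach spaces is 2-factorable if there exist a Hilbert space $H_0$ and bounded linear operators $U:E\to H_0$ and $V:H_0\to F$ with $A=VU$. *)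

theory Defs
  imports "HOL-Analysis.Analysis" "HOL-Library.Function_Algebras"
begin

instantiation "fun" :: (type, real_vector) real_vector
begin

definition scaleR_fun :: "real \<Rightarrow> ('a \<Rightarrow> 'b) \<Rightarrow> 'a \<Rightarrow> 'b"
  where "scaleR_fun c f = (\<lambda>x. c *\<^sub>R f x)"

instance
  by standard (simp_all add: scaleR_fun_def fun_eq_iff algebra_simps)

end

text \<open>
  Normed spaces are represented by a carrier inside an ambient real vector space together with
  a norm. The values of the norm outside the carrier are irrelevant: the predicates below
  only ever look at it on the carrier.
\<close>

record 'a nspace =
  carrier :: "'a set"
  nrm :: "'a \<Rightarrow> real"

definition normed_space :: "'a::real_vector nspace \<Rightarrow> bool" where
  "normed_space E \<longleftrightarrow> subspace (carrier E) \<and>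
    (\<forall>x\<in>carrier E. 0 \<le> nrm E x) \<and>
    (\<forall>x\<in>carrier E. nrm E x = 0 \<longleftrightarrow> x = 0) \<and>
    (\<forall>x\<in>carrier E. \<forall>y\<in>carrier E. nrm E (x + y) \<le> nrm E x + nrm E y) \<and>
    (\<forall>c. \<forall>x\<in>carrier E. nrm E (c *\<^sub>R x) = \<bar>c\<bar> * nrm E x)"

definition complete_nspace :: "'a::real_vector nspace \<Rightarrow> bool" where
  "complete_nspace E \<longleftrightarrow>
    (\<forall>u :: nat \<Rightarrow> 'a. (\<forall>n. u n \<in> carrier E) \<longrightarrow>
      (\<forall>e>0. \<exists>N. \<forall>m\<ge>N. \<forall>n\<ge>N. nrm E (u m - u n) < e) \<longrightarrow>
      (\<exists>l\<in>carrier E. (\<lambda>n. nrm E (u n - l)) \<longlonglongrightarrow> 0))"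

definition banach_space :: "'a::real_vector nspace \<Rightarrow> bool" where
  "banach_space E \<longleftrightarrow> normed_space E \<and> complete_nspace E"

definition inner_product_on :: "'a::real_vector set \<Rightarrow> ('a \<Rightarrow> 'a \<Rightarrow> real) \<Rightarrow> bool" where
  "inner_product_on S ip \<longleftrightarrow>
    (\<forall>x\<in>S. \<forall>y\<in>S. ip x y = ip y x) \<and>
    (\<forall>x\<in>S. \<forall>y\<in>S. \<forall>z\<in>S. ip (x + y) z = ip x z + ip y z) \<and>
    (\<forall>c. \<forall>x\<in>S. \<forall>y\<in>S. ip (c *\<^sub>R x) y = c * ip x y) \<and>
    (\<forall>x\<in>S. 0 \<le> ip x x) \<and>
    (\<forall>x\<in>S. ip x x = 0 \<longleftrightarrow> x = 0)"

definition hilbert_norm :: "'a::real_vector nspace \<Rightarrow> bool" where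
  "hilbert_norm E \<longleftrightarrow>
    (\<exists>ip. inner_product_on (carrier E) ip \<and> (\<forall>x\<in>carrier E. nrm E x = sqrt (ip x x)))"

definition hilbert_space :: "'a::real_vector nspace \<Rightarrow> bool" where
  "hilbert_space H \<longleftrightarrow> banach_space H \<and> hilbert_norm H"

definition continuous_between ::
  "'a::real_vector nspace \<Rightarrow> 'b::real_vector nspace \<Rightarrow> ('a \<Rightarrow> 'b) \<Rightarrow> bool" where
  "continuous_between E F A \<longleftrightarrow> A ` carrier E \<subseteq> carrier F \<and>
    (\<forall>x\<in>carrier E. \<forall>e>0. \<exists>d>0. \<forall>y\<in>carrier E.
      nrm E (y - x) < d \<longrightarrow> nrm F (A y - A x) < e)"

definition bounded_linear_between ::
  "'a::real_vector nspace \<Rightarrow> 'b::real_vector nspace \<Rightarrow> ('a \<Rightarrow> 'b) \<Rightarrow> bool" where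
  "bounded_linear_between E F A \<longleftrightarrow> A ` carrier E \<subseteq> carrier F \<and>
    (\<forall>x\<in>carrier E. \<forall>y\<in>carrier E. A (x + y) = A x + A y) \<and>
    (\<forall>c. \<forall>x\<in>carrier E. A (c *\<^sub>R x) = c *\<^sub>R A x) \<and>
    (\<exists>K. \<forall>x\<in>carrier E. nrm F (A x) \<le> K * nrm E x)"

text \<open>
  Since HOL has no quantification over types, the ambient vector space of the intermediate
  Hilbert space is an explicit type parameter.
\<close>

definition two_factorable ::
  "'h::real_vector itself \<Rightarrow> 'a::real_vector nspace \<Rightarrow> 'b::real_vector nspace \<Rightarrow> ('a \<Rightarrow> 'b) \<Rightarrow> bool"
  where
  "two_factorable (_ :: 'h itself) E F A \<longleftrightarrow>
    (\<exists>(H\<^sub>0 :: 'h nspace) U V. hilbert_space H\<^sub>0 \<and>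
      bounded_linear_between E H\<^sub>0 U \<and> bounded_linear_between H\<^sub>0 F V \<and>
      (\<forall>x\<in>carrier E. A x = V (U x)))"

text \<open>The set on which the functions live is the (nonempty) type \<open>'x\<close>.\<close>

definition BSF :: "('x \<Rightarrow> real) nspace \<Rightarrow> bool" where
  "BSF E \<longleftrightarrow> banach_space E"

definition real_nspace :: "real nspace" where
  "real_nspace = \<lparr>carrier = UNIV, nrm = abs\<rparr>"

definition proper_BSF :: "('x \<Rightarrow> real) nspace \<Rightarrow> bool" where
  "proper_BSF E \<longleftrightarrow> BSF E \<and> (\<forall>x. continuous_between E real_nspace (\<lambda>f. f x))"

definition RKHS :: "('x \<Rightarrow> real) nspace \<Rightarrow> bool" where
  "RKHS H \<longleftrightarrow> proper_BSF H \<and> hilbert_norm H"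

end

theory Submission
  imports Defs
begin

text \<open>
  Two mechanisms carry the theorem.

  The first is automatic continuity. If \<open>E \<subseteq> H\<close> are Banach spaces of functions whose point
  evaluations are continuous, then convergence in either norm forces pointwise convergence, so a
  sequence with limits in both norms has the same limit in both. The inclusion therefore has closed
  graph and is bounded by the closed graph theorem. Applied to \<open>E \<subseteq> H\<close> and \<open>H \<subseteq> F\<close> for an
  intermediate RKHS \<open>H\<close>, this gives the continuity of both inclusions, and with it the factorization
  of \<open>E \<subseteq> F\<close> through \<open>H\<close> itself (\<open>proper_BSF_inclusion_bounded\<close>).

  The second is the transport of a Hilbert space structure to an operator range. If \<open>id = V U\<close> on \<open>E\<close>
  with \<open>V : H\<^sub>0 \<rightarrow> F\<close> bounded and \<open>H\<^sub>0\<close> a Hilbert space, then \<open>H = V H\<^sub>0\<close> contains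
  \<open>E\<close> and is contained in \<open>F\<close>. The quotient \<open>H\<^sub>0 / ker V\<close> is isometric to the orthogonal
  complement of \<open>ker V\<close>, on which \<open>V\<close> is injective, so \<open>H\<close> is a Hilbert space under the norm of
  the shortest preimage (\<open>hilbert_structure_on_range\<close>). The inclusion \<open>H \<subseteq> F\<close> is bounded for this
  norm, and composing it with the point evaluations of \<open>F\<close> shows that those of \<open>H\<close> are continuous.

  The closed graph theorem and the orthogonal projection are proved for spaces given by a carrier
  and a norm, the former from the Baire category theorem and the latter by a minimizing
  sequence.
\<close>


section \<open>Normed spaces on a carrier\<close>

locale normed_carrier =
  fixes E :: "'a::real_vector nspace"
  assumes normed: "normed_space E"
begin

lemma subspace_carrier: "subspace (carrier E)"
  using normed by (simp add: normed_space_def)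

lemmas zero_mem = subspace_0[OF subspace_carrier]
  and add_mem = subspace_add[OF subspace_carrier]
  and diff_mem = subspace_diff[OF subspace_carrier]
  and scale_mem = subspace_scale[OF subspace_carrier]
  and sum_mem = subspace_sum[OF subspace_carrier]

lemma nrm_nonneg: "x \<in> carrier E \<Longrightarrow> 0 \<le> nrm E x"
  using normed by (simp add: normed_space_def)

lemma nrm_eq_0_iff: "x \<in> carrier E \<Longrightarrow> nrm E x = 0 \<longleftrightarrow> x = 0"
  using normed by (simp add: normed_space_def)

lemma nrm_zero: "nrm E 0 = 0"
  using nrm_eq_0_iff zero_mem by blast

lemma nrm_triangle:
  "x \<in> carrier E \<Longrightarrow> y \<in> carrier E \<Longrightarrow> nrm E (x + y) \<le> nrm E x + nrm E y"
  using normed by (simp add: normed_space_def)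

lemma nrm_scale: "x \<in> carrier E \<Longrightarrow> nrm E (c *\<^sub>R x) = \<bar>c\<bar> * nrm E x"
  using normed by (simp add: normed_space_def)

lemma nrm_minus_commute:
  assumes "x \<in> carrier E" "y \<in> carrier E"
  shows "nrm E (x - y) = nrm E (y - x)"
  using nrm_scale[OF diff_mem[OF assms], of "-1"] by simp

lemma nrm_triangle_diff:
  assumes "x \<in> carrier E" "y \<in> carrier E"
  shows "nrm E (x - y) \<le> nrm E x + nrm E y"
  using nrm_triangle[OF assms(1) scale_mem[OF assms(2), of "-1"]] nrm_scale[OF assms(2), of "-1"]
  by simp

lemma nrm_diff_triangle:
  assumes "x \<in> carrier E" "y \<in> carrier E" "z \<in> carrier E"
  shows "nrm E (x - z) \<le> nrm E (x - y) + nrm E (y - z)"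
  using nrm_triangle[OF diff_mem[OF assms(1,2)] diff_mem[OF assms(2,3)]] by simp

lemma nrm_sum:
  assumes "finite I" "\<And>i. i \<in> I \<Longrightarrow> y i \<in> carrier E"
  shows "nrm E (\<Sum>i\<in>I. y i) \<le> (\<Sum>i\<in>I. nrm E (y i))"
  using assms
proof (induction I rule: finite_induct)
  case empty
  then show ?case by (simp add: nrm_zero)
next
  case (insert i I)
  then show ?case
    using nrm_triangle[of "y i" "\<Sum>i\<in>I. y i"] sum_mem[of I y] by simp
qed

text \<open>The abstract metric space locale asks for a distance that is non-negative everywhere,
  whence the value 0 off the carrier.\<close>

definition carrier_dist :: "'a \<Rightarrow> 'a \<Rightarrow> real" where
  "carrier_dist x y = (if x \<in> carrier E \<and> y \<in> carrier E then nrm E (x - y) else 0)"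

sublocale metric: Metric_space "carrier E" carrier_dist
proof
  show "0 \<le> carrier_dist x y" for x y
    by (simp add: carrier_dist_def nrm_nonneg diff_mem)
  show "carrier_dist x y = carrier_dist y x" for x y
    by (simp add: carrier_dist_def nrm_minus_commute)
  show "carrier_dist x y = 0 \<longleftrightarrow> x = y" if "x \<in> carrier E" "y \<in> carrier E" for x y
    using that by (simp add: carrier_dist_def nrm_eq_0_iff diff_mem)
  show "carrier_dist x z \<le> carrier_dist x y + carrier_dist y z"
    if "x \<in> carrier E" "y \<in> carrier E" "z \<in> carrier E" for x y z
    using that by (simp add: carrier_dist_def nrm_diff_triangle)
qed

end

lemma linear_between_diff:
  assumes "normed_space E" "bounded_linear_between E F A" "x \<in> carrier E" "y \<in> carrier E"
  shows "A (x - y) = A x - A y"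
proof -
  interpret normed_carrier E by unfold_locales (fact assms(1))
  have "A (x + (-1) *\<^sub>R y) = A x + (-1) *\<^sub>R A y"
    using assms(2-4) scale_mem[OF assms(4), of "-1"]
    unfolding bounded_linear_between_def by metis
  then show ?thesis by simp
qed

lemma bounded_linear_imp_continuous_between:
  assumes "normed_space E" "bounded_linear_between E F A"
  shows "continuous_between E F A"
proof -
  interpret normed_carrier E by unfold_locales (fact assms(1))
  obtain K where K: "\<And>x. x \<in> carrier E \<Longrightarrow> nrm F (A x) \<le> K * nrm E x"
    using assms(2) unfolding bounded_linear_between_def by blast
  have "\<exists>d>0. \<forall>y\<in>carrier E. nrm E (y - x) < d \<longrightarrow> nrm F (A y - A x) < e"
    if "x \<in> carrier E" "e > 0" for x e
  proof (intro exI conjI ballI impI)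
    show "e / (\<bar>K\<bar> + 1) > 0" using that by simp
    fix y assume y: "y \<in> carrier E" and d: "nrm E (y - x) < e / (\<bar>K\<bar> + 1)"
    have "nrm F (A y - A x) \<le> K * nrm E (y - x)"
      using K[OF diff_mem[OF y that(1)]] linear_between_diff[OF assms y that(1)] by simp
    also have "\<dots> \<le> (\<bar>K\<bar> + 1) * nrm E (y - x)"
      using nrm_nonneg[OF diff_mem[OF y that(1)]] by (intro mult_right_mono) auto
    also have "\<dots> < e"
      using d by (simp add: field_simps add_pos_nonneg pos_less_divide_eq)
    finally show "nrm F (A y - A x) < e" .
  qed
  then show ?thesis
    using assms(2) unfolding continuous_between_def bounded_linear_between_def by blast
qed

lemma continuous_between_compose:
  assumes "continuous_between E F A" "continuous_between F G B"
  shows "continuous_between E G (\<lambda>x. B (A x))"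
  unfolding continuous_between_def
proof (intro conjI ballI allI impI)
  show "(\<lambda>x. B (A x)) ` carrier E \<subseteq> carrier G"
    using assms unfolding continuous_between_def by blast
  fix x and e :: real assume x: "x \<in> carrier E" and "e > 0"
  have mem: "A y \<in> carrier F" if "y \<in> carrier E" for y
    using that assms(1) unfolding continuous_between_def by blast
  obtain d where "d > 0"
    and d: "\<And>z. z \<in> carrier F \<Longrightarrow> nrm F (z - A x) < d \<Longrightarrow> nrm G (B z - B (A x)) < e"
    using assms(2) mem[OF x] \<open>e > 0\<close> unfolding continuous_between_def by metis
  obtain c where "c > 0"
    and "\<And>y. y \<in> carrier E \<Longrightarrow> nrm E (y - x) < c \<Longrightarrow> nrm F (A y - A x) < d"
    using assms(1) x \<open>d > 0\<close> unfolding continuous_between_def by metis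
  then show "\<exists>d>0. \<forall>y\<in>carrier E. nrm E (y - x) < d \<longrightarrow> nrm G (B (A y) - B (A x)) < e"
    using d mem by blast
qed


section \<open>Banach spaces and the closed graph theorem\<close>

locale banach_carrier = normed_carrier +
  assumes complete: "complete_nspace E"
begin

lemma Cauchy_imp_limit:
  assumes "\<And>n. u n \<in> carrier E"
    and "\<And>e. e > 0 \<Longrightarrow> \<exists>N. \<forall>m\<ge>N. \<forall>n\<ge>N. nrm E (u m - u n) < e"
  obtains l where "l \<in> carrier E" "(\<lambda>n. nrm E (u n - l)) \<longlonglongrightarrow> 0"
  using complete assms unfolding complete_nspace_def by blast

lemma mcomplete: "metric.mcomplete"
  unfolding metric.mcomplete_def
proof (intro allI impI)
  fix u assume "metric.MCauchy u"
  then have mem: "\<And>n. u n \<in> carrier E"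
    and "\<And>e. e > 0 \<Longrightarrow> \<exists>N. \<forall>m\<ge>N. \<forall>n\<ge>N. carrier_dist (u m) (u n) < e"
    unfolding metric.MCauchy_def by (simp_all add: image_subset_iff)
  then have cauchy: "\<And>e. e > 0 \<Longrightarrow> \<exists>N. \<forall>m\<ge>N. \<forall>n\<ge>N. nrm E (u m - u n) < e"
    by (simp add: carrier_dist_def)
  obtain l where l: "l \<in> carrier E" "(\<lambda>n. nrm E (u n - l)) \<longlonglongrightarrow> 0"
    using Cauchy_imp_limit[OF mem cauchy] by blast
  show "\<exists>l. limitin metric.mtopology u l sequentially"
    unfolding metric.limit_metric_sequentially
  proof (intro exI[of _ l] conjI allI impI)
    show "l \<in> carrier E" by fact
    fix e :: real assume "e > 0"
    then show "\<exists>N. \<forall>n\<ge>N. u n \<in> carrier E \<and> carrier_dist (u n) l < e"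
      using LIMSEQ_D[OF l(2) \<open>e > 0\<close>] mem l(1) by (fastforce simp: carrier_dist_def)
  qed
qed

text \<open>The bound on the limit is what turns the approximations of the next lemma into an
  operator bound in the closed graph theorem.\<close>

lemma summable_imp_series_limit:
  assumes mem: "\<And>k. y k \<in> carrier E" and le: "\<And>k. nrm E (y k) \<le> a k" and "summable a"
  obtains l where "l \<in> carrier E" "(\<lambda>n. nrm E ((\<Sum>k<n. y k) - l)) \<longlonglongrightarrow> 0"
    and "nrm E l \<le> suminf a"
proof -
  let ?S = "\<lambda>n. \<Sum>k<n. y k" and ?A = "\<lambda>n. \<Sum>k<n. a k"
  have S: "?S n \<in> carrier E" for n using mem by (intro sum_mem)
  have a_nonneg: "0 \<le> a k" for k using nrm_nonneg[OF mem] le order_trans by blast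
  have le_tail: "nrm E (?S m - ?S n) \<le> ?A m - ?A n" if "n \<le> m" for m n
  proof -
    have "?S m - ?S n = (\<Sum>k\<in>{n..<m}. y k)" and A: "?A m - ?A n = (\<Sum>k\<in>{n..<m}. a k)"
      using that sum_diff_nat_ivl[of 0 n m y] sum_diff_nat_ivl[of 0 n m a]
      by (simp_all add: atLeast0LessThan)
    moreover have "nrm E (\<Sum>k\<in>{n..<m}. y k) \<le> (\<Sum>k\<in>{n..<m}. nrm E (y k))"
      using mem by (intro nrm_sum) auto
    moreover have "\<dots> \<le> (\<Sum>k\<in>{n..<m}. a k)" using le by (intro sum_mono)
    ultimately show ?thesis by simp
  qed
  have "nrm E (?S m - ?S n) \<le> \<bar>?A m - ?A n\<bar>" for m n
    using le_tail[of n m] le_tail[of m n] nrm_minus_commute[OF S S, of m n] by linarith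
  moreover have "Cauchy ?A"
    using \<open>summable a\<close> by (simp add: summable_iff_convergent convergent_Cauchy)
  ultimately have "\<exists>N. \<forall>m\<ge>N. \<forall>n\<ge>N. nrm E (?S m - ?S n) < e" if "e > 0" for e
    using that unfolding Cauchy_def dist_real_def by (meson order_le_less_trans)
  then obtain l where l: "l \<in> carrier E" "(\<lambda>n. nrm E (?S n - l)) \<longlonglongrightarrow> 0"
    using Cauchy_imp_limit[of ?S, OF S] by blast
  have "nrm E l \<le> suminf a"
  proof (rule LIMSEQ_le_const)
    show "(\<lambda>n. suminf a + nrm E (?S n - l)) \<longlonglongrightarrow> suminf a"
      using tendsto_add[OF tendsto_const l(2)] by simp
    have "nrm E l \<le> suminf a + nrm E (?S n - l)" for n
    proof -
      have "nrm E l \<le> nrm E (?S n) + nrm E (?S n - l)"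
        using nrm_triangle_diff[OF S diff_mem[OF S l(1)], of n n] by simp
      moreover have "nrm E (?S n) \<le> ?A n" using le_tail[of 0 n] by simp
      moreover have "?A n \<le> suminf a" using \<open>summable a\<close> a_nonneg by (intro sum_le_suminf) auto
      ultimately show ?thesis by linarith
    qed
    then show "\<exists>N. \<forall>n\<ge>N. nrm E l \<le> suminf a + nrm E (?S n - l)" by blast
  qed
  with l that show thesis by blast
qed

text \<open>The category argument behind the closed graph theorem. The sublevel sets \<open>p \<le> n\<close> exhaust
  the complete space \<open>E\<close>, so the closure of one of them contains a ball. Differences of points
  of that set approximate every vector of a ball around 0, because \<open>p\<close> is subadditive, and
  homogeneity extends this to all of \<open>E\<close>. Since \<open>p\<close> may be discontinuous, passing to the closure
  loses control of \<open>x\<close> itself and leaves a bound only for the nearby vectors \<open>y\<close>.\<close>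

lemma seminorm_approximately_bounded:
  fixes p :: "'a \<Rightarrow> real"
  assumes p_diff: "\<And>x y. x \<in> carrier E \<Longrightarrow> y \<in> carrier E \<Longrightarrow> p (x - y) \<le> p x + p y"
    and p_scale: "\<And>c x. x \<in> carrier E \<Longrightarrow> p (c *\<^sub>R x) = \<bar>c\<bar> * p x"
  obtains C where "C > 0"
    "\<And>x e. x \<in> carrier E \<Longrightarrow> e > 0 \<Longrightarrow> \<exists>y\<in>carrier E. nrm E (x - y) < e \<and> p y \<le> C * nrm E x"
proof -
  define S where "S n = {x \<in> carrier E. p x \<le> real n}" for n
  let ?cl = "\<lambda>n. metric.mtopology closure_of S n"
  have "carrier E \<subseteq> (\<Union>n. ?cl n)"
  proof
    fix x assume "x \<in> carrier E"
    moreover obtain n where "p x \<le> real n" using real_arch_simple by blast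
    ultimately have "x \<in> S n" by (simp add: S_def)
    moreover have "S n \<subseteq> ?cl n" by (intro closure_of_subset) (auto simp: S_def)
    ultimately show "x \<in> (\<Union>n. ?cl n)" by blast
  qed
  then have "metric.mtopology interior_of (\<Union>n. ?cl n) \<noteq> {}"
    using zero_mem interior_of_mono[of "carrier E" "\<Union>n. ?cl n" metric.mtopology]
      interior_of_topspace[of metric.mtopology] by auto
  then have "\<exists>n. metric.mtopology interior_of ?cl n \<noteq> {}"
    using metric.metric_Baire_category_alt[OF mcomplete, of "range ?cl"] by fastforce
  then obtain n where "metric.mtopology interior_of ?cl n \<noteq> {}" ..
  then obtain x\<^sub>0 where "x\<^sub>0 \<in> metric.mtopology interior_of ?cl n" by blast
  then obtain r where r: "r > 0" "metric.mball x\<^sub>0 r \<subseteq> ?cl n"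
    using interior_of_subset[of metric.mtopology "?cl n"]
      openin_interior_of[of metric.mtopology "?cl n"]
    unfolding metric.openin_mtopology by (meson order_trans)
  have x\<^sub>0: "x\<^sub>0 \<in> carrier E"
    using \<open>x\<^sub>0 \<in> _\<close> interior_of_subset_topspace[of metric.mtopology] by auto
  have approx: "\<exists>a\<in>carrier E. p a \<le> real n \<and> nrm E (z - a) < e"
    if "z \<in> carrier E" "nrm E (x\<^sub>0 - z) < r" "e > 0" for z e
  proof -
    have "z \<in> ?cl n" using r(2) that(1,2) x\<^sub>0 by (auto simp: carrier_dist_def)
    then obtain a where "a \<in> S n" "carrier_dist z a < e"
      using \<open>e > 0\<close> unfolding metric.metric_closure_of by auto
    then show ?thesis using that(1) by (auto simp: S_def carrier_dist_def)
  qed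
  (* The summand 1 keeps C positive when n = 0. *)
  define C where "C = 4 * real n / r + 1"
  have "C > 0" using r(1) by (simp add: C_def add_nonneg_pos)
  moreover have "\<exists>y\<in>carrier E. nrm E (x - y) < e \<and> p y \<le> C * nrm E x"
    if x: "x \<in> carrier E" and e: "e > 0" for x e
  proof (cases "x = 0")
    case True
    then show ?thesis
      using e zero_mem p_scale[OF zero_mem, of 0] by (intro bexI[of _ 0]) (simp_all add: nrm_zero)
  next
    case False
    then have nx: "nrm E x > 0" using nrm_nonneg[OF x] nrm_eq_0_iff[OF x] by linarith
    (* The vector t x has norm r / 2, so x0 + t x stays inside the ball around x0. *)
    define t where "t = r / (2 * nrm E x)"
    have t: "t > 0" using r(1) nx by (simp add: t_def)
    have tx: "t *\<^sub>R x \<in> carrier E" using scale_mem[OF x] .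
    have z: "x\<^sub>0 + t *\<^sub>R x \<in> carrier E" using add_mem[OF x\<^sub>0 tx] .
    have "nrm E (x\<^sub>0 - (x\<^sub>0 + t *\<^sub>R x)) = t * nrm E x"
      using nrm_minus_commute[OF x\<^sub>0 z] nrm_scale[OF x, of t] t by simp
    also have "\<dots> < r" using r(1) nx by (simp add: t_def)
    finally obtain a where a: "a \<in> carrier E" "p a \<le> real n" "nrm E (x\<^sub>0 + t *\<^sub>R x - a) < t * e / 2"
      using approx[OF z, of "t * e / 2"] t e by auto
    obtain b where b: "b \<in> carrier E" "p b \<le> real n" "nrm E (x\<^sub>0 - b) < t * e / 2"
      using approx[OF x\<^sub>0, of "t * e / 2"] t e r(1) by (auto simp: nrm_zero)
    define y where "y = (1 / t) *\<^sub>R (a - b)"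
    have y: "y \<in> carrier E" unfolding y_def by (intro scale_mem diff_mem a b)
    have "x - y = (1 / t) *\<^sub>R ((x\<^sub>0 + t *\<^sub>R x - a) - (x\<^sub>0 - b))"
      using t by (simp add: y_def algebra_simps)
    then have "nrm E (x - y) = (1 / t) * nrm E ((x\<^sub>0 + t *\<^sub>R x - a) - (x\<^sub>0 - b))"
      using nrm_scale[OF diff_mem[OF diff_mem[OF z a(1)] diff_mem[OF x\<^sub>0 b(1)]], of "1 / t"] t
      by simp
    also have "\<dots> < (1 / t) * (t * e)"
      using nrm_triangle_diff[of "x\<^sub>0 + t *\<^sub>R x - a" "x\<^sub>0 - b"] a b z x\<^sub>0 t
      by (intro mult_strict_left_mono) (simp_all add: diff_mem)
    finally have "nrm E (x - y) < e" using t by simp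
    moreover have "p y \<le> C * nrm E x"
    proof -
      have "p y = (1 / t) * p (a - b)" using p_scale[OF diff_mem[OF a(1) b(1)]] t by (simp add: y_def)
      also have "\<dots> \<le> (1 / t) * (2 * real n)"
        using p_diff[OF a(1) b(1)] a(2) b(2) t by (intro mult_left_mono) auto
      also have "\<dots> \<le> C * nrm E x" using r(1) nx by (simp add: t_def C_def field_simps)
      finally show ?thesis .
    qed
    ultimately show ?thesis using y by blast
  qed
  ultimately show thesis using that by blast
qed

end

lemma banach_carrierI: "banach_space E \<Longrightarrow> banach_carrier E"
  by unfold_locales (simp_all add: banach_space_def)

text \<open>Approximating \<open>x\<close>, then the error, then the error of that, and so on, with errors halved at
  each step, writes \<open>x\<close> as a series \<open>\<Sum>k. y k\<close> in \<open>E\<close> whose images \<open>A (y k)\<close> are dominated by a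
  geometric series. They sum to some \<open>l\<close> in \<open>F\<close> with \<open>nrm F l \<le> 2 * C * nrm E x\<close>, and the closed
  graph identifies \<open>l\<close> with \<open>A x\<close>.\<close>

theorem closed_graph_theorem:
  assumes "banach_space E" "banach_space F"
    and mem: "A ` carrier E \<subseteq> carrier F"
    and add: "\<And>x y. x \<in> carrier E \<Longrightarrow> y \<in> carrier E \<Longrightarrow> A (x + y) = A x + A y"
    and scale: "\<And>c x. x \<in> carrier E \<Longrightarrow> A (c *\<^sub>R x) = c *\<^sub>R A x"
    and closed_graph: "\<And>u x y. (\<And>n. u n \<in> carrier E) \<Longrightarrow> x \<in> carrier E \<Longrightarrow> y \<in> carrier F \<Longrightarrow>
      (\<lambda>n. nrm E (u n - x)) \<longlonglongrightarrow> 0 \<Longrightarrow> (\<lambda>n. nrm F (A (u n) - y)) \<longlonglongrightarrow> 0 \<Longrightarrow> A x = y"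
  shows "bounded_linear_between E F A"
proof -
  interpret E: banach_carrier E by (rule banach_carrierI) fact
  interpret F: banach_carrier F by (rule banach_carrierI) fact
  have A: "A x \<in> carrier F" if "x \<in> carrier E" for x using mem that by blast
  have A_diff: "A (x - y) = A x - A y" if "x \<in> carrier E" "y \<in> carrier E" for x y
    using add[OF that(1) E.scale_mem[OF that(2), of "-1"]] scale[OF that(2), of "-1"] by simp
  have A_zero: "A 0 = 0" using scale[OF E.zero_mem, of 0] by simp
  obtain C where "C > 0"
    and C: "\<And>x e. x \<in> carrier E \<Longrightarrow> e > 0 \<Longrightarrow>
      \<exists>y\<in>carrier E. nrm E (x - y) < e \<and> nrm F (A y) \<le> C * nrm E x"
  proof (rule E.seminorm_approximately_bounded[of "\<lambda>x. nrm F (A x)"])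
    show "nrm F (A (x - y)) \<le> nrm F (A x) + nrm F (A y)"
      if "x \<in> carrier E" "y \<in> carrier E" for x y
      using F.nrm_triangle_diff A A_diff that by simp
    show "nrm F (A (c *\<^sub>R x)) = \<bar>c\<bar> * nrm F (A x)" if "x \<in> carrier E" for c x
      using F.nrm_scale A scale that by simp
  qed blast
  then obtain g where g: "\<And>x e. x \<in> carrier E \<Longrightarrow> e > 0 \<Longrightarrow> g x e \<in> carrier E"
    and g_close: "\<And>x e. x \<in> carrier E \<Longrightarrow> e > 0 \<Longrightarrow> nrm E (x - g x e) < e"
    and g_bound: "\<And>x e. x \<in> carrier E \<Longrightarrow> e > 0 \<Longrightarrow> nrm F (A (g x e)) \<le> C * nrm E x"
    by metis
  have "nrm F (A x) \<le> 2 * C * nrm E x" if x: "x \<in> carrier E" for x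
  proof (cases "x = 0")
    case True
    then show ?thesis by (simp add: A_zero E.nrm_zero F.nrm_zero)
  next
    case False
    define M where "M = nrm E x"
    have M: "M > 0" using False E.nrm_nonneg[OF x] E.nrm_eq_0_iff[OF x] by (simp add: M_def)
    (* r k is the error left after k steps, y k the vector of controlled image
       approximating it. *)
    define r where "r = rec_nat x (\<lambda>k z. z - g z (M * (1 / 2) ^ Suc k))"
    define y where "y k = g (r k) (M * (1 / 2) ^ Suc k)" for k
    have r0: "r 0 = x" and rSuc: "r (Suc k) = r k - y k" for k by (simp_all add: r_def y_def)
    have e: "M * (1 / 2) ^ k > 0" for k using M by simp
    have r: "r k \<in> carrier E" for k
      by (induction k) (simp_all add: r0 x rSuc y_def E.diff_mem g[OF _ e] del: power_Suc)
    have y: "y k \<in> carrier E" for k using g[OF r e] by (simp add: y_def del: power_Suc)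
    have r_le: "nrm E (r k) \<le> M * (1 / 2) ^ k" for k
    proof (cases k)
      case (Suc j)
      then show ?thesis using g_close[OF r e, of j "Suc j"] by (simp add: rSuc y_def del: power_Suc)
    qed (simp add: r0 M_def)
    have y_le: "nrm F (A (y k)) \<le> C * M * (1 / 2) ^ k" for k
      using order_trans[OF g_bound[OF r e, of k "Suc k"] mult_left_mono[OF r_le, of C k]] \<open>C > 0\<close>
      by (simp add: y_def mult.assoc del: power_Suc)
    have sums: "(\<lambda>k. C * M * (1 / 2) ^ k) sums (C * M * 2)"
      using sums_mult[OF geometric_sums[of "1 / 2 :: real"], of "C * M"] by simp
    obtain l where l: "l \<in> carrier F" "(\<lambda>n. nrm F ((\<Sum>k<n. A (y k)) - l)) \<longlonglongrightarrow> 0"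
      and l_le: "nrm F l \<le> (\<Sum>k. C * M * (1 / 2) ^ k)"
      using F.summable_imp_series_limit[OF A[OF y] y_le sums_summable[OF sums]] by blast
    have S: "(\<Sum>k<n. y k) \<in> carrier E" for n using y by (intro E.sum_mem)
    have A_sum: "A (\<Sum>k<n. y k) = (\<Sum>k<n. A (y k))" for n
      by (induction n) (simp_all add: A_zero add S y)
    have "(\<Sum>k<n. y k) = x - r n" for n
      by (induction n) (simp_all add: r0 rSuc)
    then have "nrm E ((\<Sum>k<n. y k) - x) = nrm E (r n)" for n
      using E.nrm_scale[OF r, of "-1" n] by simp
    moreover have "(\<lambda>n. nrm E (r n)) \<longlonglongrightarrow> 0"
    proof (rule tendsto_sandwich[OF _ _ tendsto_const])
      show "(\<lambda>n. M * (1 / 2) ^ n) \<longlonglongrightarrow> 0"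
        using tendsto_mult_right_zero[OF LIMSEQ_power_zero[of "1 / 2 :: real"], of M] by simp
    qed (simp_all add: r_le E.nrm_nonneg r)
    ultimately have "A x = l"
      using closed_graph[OF S x l(1)] l(2) by (simp add: A_sum)
    then show ?thesis using l_le sums_unique[OF sums] by (simp add: M_def mult_ac)
  qed
  then show ?thesis
    using mem add scale unfolding bounded_linear_between_def by blast
qed


section \<open>Hilbert spaces: orthogonal projection and operator ranges\<close>

locale hilbert_carrier = banach_carrier H for H :: "'a::real_vector nspace" +
  fixes ip :: "'a \<Rightarrow> 'a \<Rightarrow> real"
  assumes inner: "inner_product_on (carrier H) ip"
    and nrm_eq: "\<And>x. x \<in> carrier H \<Longrightarrow> nrm H x = sqrt (ip x x)"
begin

lemma ip_commute: "x \<in> carrier H \<Longrightarrow> y \<in> carrier H \<Longrightarrow> ip x y = ip y x"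
  using inner by (simp add: inner_product_on_def)

lemma ip_add_left: "x \<in> carrier H \<Longrightarrow> y \<in> carrier H \<Longrightarrow> z \<in> carrier H \<Longrightarrow>
    ip (x + y) z = ip x z + ip y z"
  using inner by (simp add: inner_product_on_def)

lemma ip_scale_left: "x \<in> carrier H \<Longrightarrow> y \<in> carrier H \<Longrightarrow> ip (c *\<^sub>R x) y = c * ip x y"
  using inner by (simp add: inner_product_on_def)

lemma ip_self_nonneg: "x \<in> carrier H \<Longrightarrow> 0 \<le> ip x x"
  using inner by (simp add: inner_product_on_def)

lemma ip_self_eq_0_iff: "x \<in> carrier H \<Longrightarrow> ip x x = 0 \<longleftrightarrow> x = 0"
  using inner by (simp add: inner_product_on_def)

lemma ip_add_right: "x \<in> carrier H \<Longrightarrow> y \<in> carrier H \<Longrightarrow> z \<in> carrier H \<Longrightarrow>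
    ip z (x + y) = ip z x + ip z y"
  by (metis ip_add_left ip_commute add_mem)

lemma ip_scale_right: "x \<in> carrier H \<Longrightarrow> y \<in> carrier H \<Longrightarrow> ip y (c *\<^sub>R x) = c * ip y x"
  by (metis ip_scale_left ip_commute scale_mem)

lemma ip_diff_left: "x \<in> carrier H \<Longrightarrow> y \<in> carrier H \<Longrightarrow> z \<in> carrier H \<Longrightarrow>
    ip (x - y) z = ip x z - ip y z"
  using ip_add_left[of x "(-1) *\<^sub>R y" z] ip_scale_left[of y z "-1"] scale_mem[of y "-1"] by simp

lemma ip_diff_right: "x \<in> carrier H \<Longrightarrow> y \<in> carrier H \<Longrightarrow> z \<in> carrier H \<Longrightarrow>
    ip z (x - y) = ip z x - ip z y"
  by (metis ip_diff_left ip_commute diff_mem)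

lemmas ip_simps = ip_add_left ip_add_right ip_diff_left ip_diff_right ip_scale_left ip_scale_right

lemma nrm_square: "x \<in> carrier H \<Longrightarrow> (nrm H x)\<^sup>2 = ip x x"
  by (simp add: nrm_eq ip_self_nonneg)

lemma parallelogram:
  assumes "x \<in> carrier H" "y \<in> carrier H"
  shows "(nrm H (x + y))\<^sup>2 + (nrm H (x - y))\<^sup>2 = 2 * (nrm H x)\<^sup>2 + 2 * (nrm H y)\<^sup>2"
  using assms by (simp add: nrm_square ip_simps add_mem diff_mem)

lemma minimizer_imp_orthogonal:
  assumes x: "x \<in> carrier H" and m: "m \<in> carrier H"
    and min: "\<And>t. nrm H x \<le> nrm H (x - t *\<^sub>R m)"
  shows "ip x m = 0"
proof (cases "m = 0")
  case True
  then show ?thesis using ip_scale_right[OF m x, of 0] by simp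
next
  case False
  then have pos: "ip m m > 0" using ip_self_nonneg[OF m] ip_self_eq_0_iff[OF m] by linarith
  (* The value of t at which the distance from x to the line spanned by m is attained. *)
  define t where "t = ip x m / ip m m"
  have tm: "t *\<^sub>R m \<in> carrier H" using scale_mem[OF m] .
  have "(nrm H x)\<^sup>2 \<le> (nrm H (x - t *\<^sub>R m))\<^sup>2"
    using min nrm_nonneg[OF x] by (intro power_mono)
  also have "\<dots> = ip x x - 2 * t * ip x m + t * t * ip m m"
    using x m tm by (simp add: nrm_square ip_simps diff_mem ip_commute[OF m x] algebra_simps)
  finally have "2 * t * ip x m \<le> t * t * ip m m" using nrm_square[OF x] by simp
  then have "(ip x m)\<^sup>2 \<le> 0" using pos by (simp add: t_def field_simps power2_eq_square)
  then show ?thesis by simp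
qed

text \<open>A sequence in \<open>N\<close> minimizing the distance to \<open>h\<close> is Cauchy: by the parallelogram law two
  near-minimizers that were far apart would have a midpoint closer to \<open>h\<close> than the infimum.\<close>

theorem orthogonal_projection_exists:
  assumes sub: "subspace N" "N \<subseteq> carrier H"
    and closed: "\<And>u l. (\<And>k. u k \<in> N) \<Longrightarrow> l \<in> carrier H \<Longrightarrow> (\<lambda>k. nrm H (u k - l)) \<longlonglongrightarrow> 0 \<Longrightarrow> l \<in> N"
    and h: "h \<in> carrier H"
  obtains n where "n \<in> N" "\<And>m. m \<in> N \<Longrightarrow> ip (h - n) m = 0"
proof -
  define D where "D = (\<lambda>n. nrm H (h - n)) ` N"
  define d where "d = Inf D"
  have N: "n \<in> carrier H" if "n \<in> N" for n using sub(2) that by blast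
  have hN: "h - n \<in> carrier H" if "n \<in> N" for n using diff_mem[OF h N[OF that]] .
  have D: "D \<noteq> {}" "bdd_below D" "\<And>c. c \<in> D \<Longrightarrow> 0 \<le> c"
    using subspace_0[OF sub(1)] nrm_nonneg hN unfolding D_def bdd_below_def by blast+
  have d_le: "d \<le> nrm H (h - n)" if "n \<in> N" for n
    unfolding d_def using D(2) that by (intro cInf_lower) (auto simp: D_def)
  have d0: "0 \<le> d" unfolding d_def using D by (intro cInf_greatest)
  have "\<exists>n\<in>N. (nrm H (h - n))\<^sup>2 < d\<^sup>2 + e" if "e > 0" for e
  proof -
    have "d < sqrt (d\<^sup>2 + e)" using that by (intro real_less_rsqrt) simp
    then obtain n where n: "n \<in> N" "nrm H (h - n) < sqrt (d\<^sup>2 + e)"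
      using cInf_lessD[OF D(1)] unfolding d_def D_def by blast
    then have "(nrm H (h - n))\<^sup>2 < (sqrt (d\<^sup>2 + e))\<^sup>2"
      using nrm_nonneg[OF hN] by (intro power_strict_mono) auto
    with n that show ?thesis by (auto intro!: bexI[of _ n])
  qed
  from this[of "1 / real (Suc _)"]
  obtain u where u: "\<And>k. u k \<in> N" and u_min: "\<And>k. (nrm H (h - u k))\<^sup>2 < d\<^sup>2 + 1 / real (Suc k)"
    by (metis of_nat_0_less_iff zero_less_Suc zero_less_divide_1_iff)
  have u_diff: "(nrm H (u j - u k))\<^sup>2 \<le> 2 / real (Suc j) + 2 / real (Suc k)" for j k
  proof -
    (* The midpoint lies in N, so its distance to h is at least d. *)
    define v where "v = (1 / 2 :: real) *\<^sub>R (u j + u k)"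
    have v: "v \<in> N" unfolding v_def by (intro subspace_scale subspace_add sub u)
    have "(h - u j) + (h - u k) = 2 *\<^sub>R (h - v)"
      by (simp add: v_def algebra_simps scaleR_2)
    then have "(nrm H ((h - u j) + (h - u k)))\<^sup>2 = 4 * (nrm H (h - v))\<^sup>2"
      using nrm_scale[OF hN[OF v], of 2] by (simp add: power_mult_distrib)
    moreover have "d\<^sup>2 \<le> (nrm H (h - v))\<^sup>2" using d_le[OF v] d0 by (intro power_mono)
    moreover have "(nrm H ((h - u j) - (h - u k)))\<^sup>2 = (nrm H (u j - u k))\<^sup>2"
      using nrm_minus_commute[OF N[OF u] N[OF u]] by (simp add: algebra_simps)
    ultimately show ?thesis
      using parallelogram[OF hN[OF u] hN[OF u], of j k] u_min[of j] u_min[of k] by simp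
  qed
  have "\<exists>K. \<forall>j\<ge>K. \<forall>k\<ge>K. nrm H (u j - u k) < e" if "e > 0" for e
  proof -
    obtain K where K: "4 / e\<^sup>2 < real K" using reals_Archimedean2 by blast
    have "nrm H (u j - u k) < e" if "j \<ge> K" "k \<ge> K" for j k
    proof (rule power_less_imp_less_base)
      have "4 / e\<^sup>2 < real (Suc K)" using K by simp
      then have "4 / real (Suc K) < e\<^sup>2" using \<open>e > 0\<close> by (simp add: field_simps)
      moreover have "2 / real (Suc j) \<le> 2 / real (Suc K)" "2 / real (Suc k) \<le> 2 / real (Suc K)"
        using that by (simp_all add: frac_le)
      ultimately show "(nrm H (u j - u k))\<^sup>2 < e\<^sup>2" using u_diff[of j k] by simp
    qed (use \<open>e > 0\<close> in simp)
    then show ?thesis by blast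
  qed
  then obtain n where n: "n \<in> carrier H" "(\<lambda>k. nrm H (u k - n)) \<longlonglongrightarrow> 0"
    using Cauchy_imp_limit[of u, OF N[OF u]] by blast
  have nN: "n \<in> N" using closed[OF u n] .
  have "(nrm H (h - n)) \<le> d"
  proof (rule LIMSEQ_le_const)
    have "(\<lambda>k. d\<^sup>2 + 1 / real (Suc k)) \<longlonglongrightarrow> d\<^sup>2 + 0"
      by (intro tendsto_add tendsto_const LIMSEQ_Suc[OF lim_1_over_n])
    then have "(\<lambda>k. sqrt (d\<^sup>2 + 1 / real (Suc k))) \<longlonglongrightarrow> sqrt (d\<^sup>2 + 0)"
      by (rule tendsto_real_sqrt)
    then show "(\<lambda>k. sqrt (d\<^sup>2 + 1 / real (Suc k)) + nrm H (u k - n)) \<longlonglongrightarrow> d"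
      using tendsto_add[OF _ n(2)] d0 by fastforce
    have "nrm H (h - n) \<le> sqrt (d\<^sup>2 + 1 / real (Suc k)) + nrm H (u k - n)" for k
      using nrm_diff_triangle[OF h N[OF u] n(1), of k] real_le_rsqrt[OF less_imp_le[OF u_min[of k]]]
      by linarith
    then show "\<exists>K. \<forall>k\<ge>K. nrm H (h - n) \<le> sqrt (d\<^sup>2 + 1 / real (Suc k)) + nrm H (u k - n)" by blast
  qed
  moreover have "d \<le> nrm H (h - n - t *\<^sub>R m)" if "m \<in> N" for t m
    using d_le[of "n + t *\<^sub>R m"] subspace_add[OF sub(1) nN subspace_scale[OF sub(1) that, of t]]
    by (simp add: algebra_simps)
  ultimately have "ip (h - n) m = 0" if "m \<in> N" for m
    using minimizer_imp_orthogonal[OF hN[OF nN] N[OF that]] that order_trans by blast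
  with nN that show thesis by blast
qed

end

text \<open>Every fibre of \<open>V\<close> contains exactly one vector orthogonal to the kernel \<open>N\<close> of \<open>V\<close>, and that
  vector is the shortest in its fibre. The section \<open>R\<close> picking it is linear, so the inner product of
  \<open>H\<^sub>0\<close> pulls back along \<open>R\<close> to the range. Minimality gives completeness: if \<open>R (u n)\<close> converges to
  \<open>l\<close>, then \<open>R (u n) - l\<close> is a preimage of \<open>u n - V l\<close>, which is therefore at most as long.\<close>

theorem hilbert_structure_on_range:
  fixes F :: "'b::real_vector nspace"
  assumes "hilbert_space H\<^sub>0" "normed_space F" and V: "bounded_linear_between H\<^sub>0 F V"
  obtains H where "hilbert_space H" "carrier H = V ` carrier H\<^sub>0" "bounded_linear_between H F id"
proof -
  obtain ip where "inner_product_on (carrier H\<^sub>0) ip" "\<And>x. x \<in> carrier H\<^sub>0 \<Longrightarrow> nrm H\<^sub>0 x = sqrt (ip x x)"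
    using assms(1) unfolding hilbert_space_def hilbert_norm_def by blast
  then interpret H\<^sub>0: hilbert_carrier H\<^sub>0 ip
    using assms(1) by unfold_locales (simp_all add: hilbert_space_def banach_space_def)
  interpret F: normed_carrier F by unfold_locales fact
  have V_mem: "\<And>x. x \<in> carrier H\<^sub>0 \<Longrightarrow> V x \<in> carrier F"
    and V_add: "\<And>x y. x \<in> carrier H\<^sub>0 \<Longrightarrow> y \<in> carrier H\<^sub>0 \<Longrightarrow> V (x + y) = V x + V y"
    and V_scale: "\<And>c x. x \<in> carrier H\<^sub>0 \<Longrightarrow> V (c *\<^sub>R x) = c *\<^sub>R V x"
    using V unfolding bounded_linear_between_def by blast+
  note V_diff = linear_between_diff[OF H\<^sub>0.normed V]
  have V_zero: "V 0 = 0" using V_scale[OF H\<^sub>0.zero_mem, of 0] by simp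
  obtain K where K: "\<And>x. x \<in> carrier H\<^sub>0 \<Longrightarrow> nrm F (V x) \<le> K * nrm H\<^sub>0 x"
    using V unfolding bounded_linear_between_def by blast
  define N where "N = {n \<in> carrier H\<^sub>0. V n = 0}"
  have N_sub: "subspace N" "N \<subseteq> carrier H\<^sub>0"
    unfolding N_def subspace_def
    by (auto simp: V_zero V_add V_scale H\<^sub>0.zero_mem H\<^sub>0.add_mem H\<^sub>0.scale_mem)
  (* The kernel is closed because V is bounded; this is what the projection onto it requires. *)
  have N_closed: "l \<in> N"
    if u: "\<And>k. u k \<in> N" and l: "l \<in> carrier H\<^sub>0" "(\<lambda>k. nrm H\<^sub>0 (u k - l)) \<longlonglongrightarrow> 0" for u l
  proof -
    have "nrm F (V l) \<le> K * nrm H\<^sub>0 (u k - l)" for k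
    proof -
      have uk: "u k \<in> carrier H\<^sub>0" "V (u k) = 0" using u[of k] by (auto simp: N_def)
      have "V (u k - l) = (-1) *\<^sub>R V l" using V_diff[OF uk(1) l(1)] uk(2) by simp
      then show ?thesis
        using K[OF H\<^sub>0.diff_mem[OF uk(1) l(1)]] F.nrm_scale[OF V_mem[OF l(1)], of "-1"] by simp
    qed
    then have "nrm F (V l) \<le> 0"
      using LIMSEQ_le_const[OF tendsto_mult_right_zero[OF l(2), of K], of "nrm F (V l)"] by blast
    then have "V l = 0"
      using F.nrm_nonneg[OF V_mem[OF l(1)]] F.nrm_eq_0_iff[OF V_mem[OF l(1)]] by simp
    with l(1) show ?thesis by (simp add: N_def)
  qed
  (* P f p: p is the preimage of f orthogonal to the kernel. *)
  define P where "P f p \<longleftrightarrow> p \<in> carrier H\<^sub>0 \<and> V p = f \<and> (\<forall>m\<in>N. ip p m = 0)" for f p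
  have P_unique: "p = q" if "P f p" "P f q" for f p q
  proof -
    have pq: "p \<in> carrier H\<^sub>0" "q \<in> carrier H\<^sub>0" using that by (auto simp: P_def)
    have "p - q \<in> N" using that V_diff[OF pq] H\<^sub>0.diff_mem[OF pq] by (simp add: N_def P_def)
    then have "ip p (p - q) = 0" "ip q (p - q) = 0" using that unfolding P_def by blast+
    then have "ip (p - q) (p - q) = 0"
      using H\<^sub>0.ip_diff_left[OF pq H\<^sub>0.diff_mem[OF pq]] by simp
    then show ?thesis using H\<^sub>0.ip_self_eq_0_iff[OF H\<^sub>0.diff_mem[OF pq]] by simp
  qed
  have P_exists: "\<exists>p. P (V h) p" if h: "h \<in> carrier H\<^sub>0" for h
  proof -
    obtain n where n: "n \<in> N" "\<And>m. m \<in> N \<Longrightarrow> ip (h - n) m = 0"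
    proof (rule H\<^sub>0.orthogonal_projection_exists[OF N_sub _ h])
      show "l \<in> N" if "\<And>k. u k \<in> N" "l \<in> carrier H\<^sub>0" "(\<lambda>k. nrm H\<^sub>0 (u k - l)) \<longlonglongrightarrow> 0" for u l
        using N_closed[of u l] that by blast
    qed blast
    then have "n \<in> carrier H\<^sub>0" "V n = 0" by (auto simp: N_def)
    then have "P (V h) (h - n)"
      using n(2) h V_diff[OF h] H\<^sub>0.diff_mem[OF h] by (simp add: P_def)
    then show ?thesis by blast
  qed
  define R where "R f = (THE p. P f p)" for f
  let ?S = "V ` carrier H\<^sub>0"
  have R_eqI: "R f = p" if "P f p" for f p
    unfolding R_def using that P_unique by (intro the_equality)
  have PR: "P f (R f)" if "f \<in> ?S" for f
    using that P_exists R_eqI by (metis imageE)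
  have R_mem: "R f \<in> carrier H\<^sub>0" and V_R: "V (R f) = f"
    and R_orth: "\<And>m. m \<in> N \<Longrightarrow> ip (R f) m = 0" if "f \<in> ?S" for f
    using PR[OF that] by (auto simp: P_def)
  have N_mem: "m \<in> carrier H\<^sub>0" if "m \<in> N" for m using that by (simp add: N_def)
  have R_add: "R (f + g) = R f + R g" if "f \<in> ?S" "g \<in> ?S" for f g
    using that by (intro R_eqI)
      (simp add: P_def V_add R_mem V_R R_orth H\<^sub>0.add_mem H\<^sub>0.ip_add_left N_mem)
  have R_scale: "R (c *\<^sub>R f) = c *\<^sub>R R f" if "f \<in> ?S" for c f
    using that by (intro R_eqI)
      (simp add: P_def V_scale R_mem V_R R_orth H\<^sub>0.scale_mem H\<^sub>0.ip_scale_left N_mem)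
  have S_sub: "subspace ?S"
    unfolding subspace_def
  proof (intro conjI ballI allI)
    show "0 \<in> ?S" using V_zero H\<^sub>0.zero_mem by (metis imageI)
    show "f + g \<in> ?S" if "f \<in> ?S" "g \<in> ?S" for f g
      using that V_add H\<^sub>0.add_mem by (auto simp flip: V_add)
    show "c *\<^sub>R f \<in> ?S" if "f \<in> ?S" for c f
      using that V_scale H\<^sub>0.scale_mem by (auto simp flip: V_scale)
  qed
  have R_zero_iff: "R f = 0 \<longleftrightarrow> f = 0" if "f \<in> ?S" for f
    using V_R[OF that] V_zero R_scale[OF that, of 0] by auto
  (* Pythagoras: h is the orthogonal sum of R (V h) and an element of the kernel. *)
  have R_minimal: "nrm H\<^sub>0 (R (V h)) \<le> nrm H\<^sub>0 h" if h: "h \<in> carrier H\<^sub>0" for h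
  proof -
    define p where "p = R (V h)"
    have p: "p \<in> carrier H\<^sub>0" "V p = V h" "\<And>m. m \<in> N \<Longrightarrow> ip p m = 0"
      using R_mem V_R R_orth h by (auto simp: p_def)
    have hp: "h - p \<in> carrier H\<^sub>0" using H\<^sub>0.diff_mem[OF h p(1)] .
    have "h - p \<in> N" using hp V_diff[OF h p(1)] p(2) by (simp add: N_def)
    then have "ip p (h - p) = 0" using p(3) by blast
    then have "ip h h = ip p p + ip (h - p) (h - p)"
      using h p(1) hp H\<^sub>0.ip_commute[OF h p(1)] by (simp add: H\<^sub>0.ip_simps)
    then have "ip p p \<le> ip h h" using H\<^sub>0.ip_self_nonneg[OF hp] by simp
    then show ?thesis using H\<^sub>0.nrm_eq h p(1) by (simp add: p_def)
  qed
  define H where "H = \<lparr>carrier = ?S, nrm = \<lambda>f. nrm H\<^sub>0 (R f)\<rparr>"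
  have carrier_H: "carrier H = ?S" and nrm_H: "nrm H f = nrm H\<^sub>0 (R f)" for f
    by (simp_all add: H_def)
  have R_diff: "R (f - g) = R f - R g" if "f \<in> ?S" "g \<in> ?S" for f g
    using R_add[OF that(1) subspace_scale[OF S_sub that(2), of "-1"]] R_scale[OF that(2), of "-1"]
    by simp
  have "normed_space H"
    unfolding normed_space_def carrier_H nrm_H
    using S_sub by (simp add: R_mem H\<^sub>0.nrm_nonneg H\<^sub>0.nrm_eq_0_iff R_zero_iff R_add R_scale
        H\<^sub>0.nrm_triangle H\<^sub>0.nrm_scale del: image_iff)
  moreover have "complete_nspace H"
    unfolding complete_nspace_def carrier_H
  proof (intro allI impI)
    fix u :: "nat \<Rightarrow> 'b"
    assume "\<forall>n. u n \<in> ?S" and cauchy: "\<forall>e>0. \<exists>N. \<forall>m\<ge>N. \<forall>n\<ge>N. nrm H (u m - u n) < e"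
    then have u: "u n \<in> ?S" for n by blast
    have "\<exists>N. \<forall>m\<ge>N. \<forall>n\<ge>N. nrm H\<^sub>0 (R (u m) - R (u n)) < e" if "e > 0" for e
      using cauchy that by (simp add: nrm_H R_diff[OF u u])
    then obtain l where l: "l \<in> carrier H\<^sub>0" "(\<lambda>n. nrm H\<^sub>0 (R (u n) - l)) \<longlonglongrightarrow> 0"
      using H\<^sub>0.Cauchy_imp_limit[of "\<lambda>n. R (u n)", OF R_mem[OF u]] by blast
    have Vl: "V l \<in> ?S" using l(1) by blast
    have "nrm H (u n - V l) \<le> nrm H\<^sub>0 (R (u n) - l)" for n
      using R_minimal[OF H\<^sub>0.diff_mem[OF R_mem[OF u] l(1)]]
      by (simp add: nrm_H V_diff[OF R_mem[OF u] l(1)] V_R[OF u])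
    moreover have "0 \<le> nrm H (u n - V l)" for n
      using H\<^sub>0.nrm_nonneg[OF R_mem[OF subspace_diff[OF S_sub u Vl]]] by (simp add: nrm_H)
    ultimately have "(\<lambda>n. nrm H (u n - V l)) \<longlonglongrightarrow> 0"
      by (intro tendsto_sandwich[OF _ _ tendsto_const l(2)]) simp_all
    with Vl show "\<exists>l\<in>?S. (\<lambda>n. nrm H (u n - l)) \<longlonglongrightarrow> 0" by blast
  qed
  moreover have "hilbert_norm H"
    unfolding hilbert_norm_def inner_product_on_def carrier_H nrm_H
    by (intro exI[of _ "\<lambda>f g. ip (R f) (R g)"] conjI ballI allI)
      (simp_all only: R_add R_scale R_mem R_zero_iff H\<^sub>0.ip_add_left H\<^sub>0.ip_scale_left
        H\<^sub>0.ip_self_nonneg H\<^sub>0.ip_self_eq_0_iff H\<^sub>0.nrm_eq H\<^sub>0.ip_commute)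
  ultimately have "hilbert_space H" by (simp add: hilbert_space_def banach_space_def)
  moreover have "bounded_linear_between H F id"
    unfolding bounded_linear_between_def carrier_H nrm_H
  proof (intro conjI exI ballI)
    show "id ` ?S \<subseteq> carrier F" using V_mem by auto
    show "nrm F (id f) \<le> K * nrm H\<^sub>0 (R f)" if "f \<in> ?S" for f
      using K[OF R_mem[OF that]] V_R[OF that] by simp
  qed simp_all
  ultimately show thesis using that carrier_H by blast
qed


section \<open>Proper Banach spaces of functions\<close>

lemma proper_BSF_norm_limit_imp_pointwise:
  assumes "proper_BSF E" "\<And>n. u n \<in> carrier E" "f \<in> carrier E" "(\<lambda>n. nrm E (u n - f)) \<longlonglongrightarrow> 0"
  shows "(\<lambda>n. u n x) \<longlonglongrightarrow> f x"
proof (rule LIMSEQ_I)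
  fix e :: real assume "e > 0"
  obtain d where "d > 0"
    and d: "\<And>g. g \<in> carrier E \<Longrightarrow> nrm E (g - f) < d \<Longrightarrow> \<bar>g x - f x\<bar> < e"
    using assms(1,3) \<open>e > 0\<close>
    unfolding proper_BSF_def continuous_between_def real_nspace_def by fastforce
  obtain N where "\<And>n. n \<ge> N \<Longrightarrow> nrm E (u n - f) < d"
    using LIMSEQ_D[OF assms(4) \<open>d > 0\<close>] by fastforce
  with d assms(2) show "\<exists>N. \<forall>n\<ge>N. norm (u n x - f x) < e" by auto
qed

text \<open>Limits in the two norms are both pointwise limits, so they agree and the graph of the
  inclusion is closed.\<close>

theorem proper_BSF_inclusion_bounded:
  assumes E: "proper_BSF E" and F: "proper_BSF F" and "carrier E \<subseteq> carrier F"
  shows "bounded_linear_between E F id"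
proof (rule closed_graph_theorem)
  show "banach_space E" "banach_space F" using E F by (simp_all add: proper_BSF_def BSF_def)
  show "id ` carrier E \<subseteq> carrier F" using assms(3) by simp
  fix u :: "nat \<Rightarrow> 'a \<Rightarrow> real" and f g
  assume u: "\<And>n. u n \<in> carrier E" and "f \<in> carrier E" "g \<in> carrier F"
    and "(\<lambda>n. nrm E (u n - f)) \<longlonglongrightarrow> 0" "(\<lambda>n. nrm F (id (u n) - g)) \<longlonglongrightarrow> 0"
  then have "(\<lambda>n. u n x) \<longlonglongrightarrow> f x" "(\<lambda>n. u n x) \<longlonglongrightarrow> g x" for x
    using proper_BSF_norm_limit_imp_pointwise[OF E] proper_BSF_norm_limit_imp_pointwise[OF F]
      assms(3) by (simp_all add: subset_iff)
  then show "id f = g" using LIMSEQ_unique by (fastforce simp: fun_eq_iff)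
qed simp_all

lemma proper_BSF_inclusion_continuous:
  assumes "proper_BSF E" "proper_BSF F" "carrier E \<subseteq> carrier F"
  shows "continuous_between E F id"
  using bounded_linear_imp_continuous_between[OF _ proper_BSF_inclusion_bounded[OF assms]] assms(1)
  by (simp add: proper_BSF_def BSF_def banach_space_def)

text \<open>The functions of \<open>H = V H\<^sub>0\<close> live on the same set as those of \<open>F\<close>, whatever the ambient
  space of \<open>H\<^sub>0\<close> is. This is why the type \<open>'h\<close> can be arbitrary.\<close>

lemma two_factorable_imp_intermediate_RKHS:
  assumes F: "proper_BSF F" and "two_factorable TYPE('h::real_vector) E F id"
  shows "\<exists>H. RKHS H \<and> carrier E \<subseteq> carrier H \<and> carrier H \<subseteq> carrier F"
proof -
  obtain H\<^sub>0 :: "'h nspace" and U V where "hilbert_space H\<^sub>0"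
    and U: "bounded_linear_between E H\<^sub>0 U" and V: "bounded_linear_between H\<^sub>0 F V"
    and factor: "\<And>f. f \<in> carrier E \<Longrightarrow> f = V (U f)"
    using assms(2) unfolding two_factorable_def by auto
  moreover have "normed_space F" using F by (simp add: proper_BSF_def BSF_def banach_space_def)
  ultimately obtain H where H: "hilbert_space H" "carrier H = V ` carrier H\<^sub>0"
    "bounded_linear_between H F id"
    using hilbert_structure_on_range by blast
  have "continuous_between H F id"
    using bounded_linear_imp_continuous_between[OF _ H(3)] H(1)
    by (simp add: hilbert_space_def banach_space_def)
  then have "continuous_between H real_nspace (\<lambda>f. f x)" for x
    using continuous_between_compose[of H F id real_nspace "\<lambda>f. f x"] F by (simp add: proper_BSF_def)
  then have "RKHS H" using H(1) by (simp add: RKHS_def proper_BSF_def BSF_def hilbert_space_def)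
  moreover have "carrier E \<subseteq> carrier H"
    using U factor unfolding H(2) bounded_linear_between_def by blast
  moreover have "carrier H \<subseteq> carrier F"
    using V unfolding H(2) bounded_linear_between_def by blast
  ultimately show ?thesis by blast
qed

text \<open>\<open>H\<close> itself is the intermediate Hilbert space, with both factors the identity. Its elements are
  functions, hence the ambient type of functions in the conclusion.\<close>

lemma intermediate_RKHS_imp_two_factorable:
  fixes E F H :: "('x \<Rightarrow> real) nspace"
  assumes "proper_BSF E" "proper_BSF F" "RKHS H" "carrier E \<subseteq> carrier H" "carrier H \<subseteq> carrier F"
  shows "two_factorable TYPE('x \<Rightarrow> real) E F id"
proof -
  have H: "proper_BSF H" "hilbert_space H"
    using assms(3) by (simp_all add: RKHS_def proper_BSF_def BSF_def hilbert_space_def)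
  have "\<forall>f\<in>carrier E. id f = id (id f)" by simp
  then show ?thesis
    unfolding two_factorable_def
    using H(2) proper_BSF_inclusion_bounded[OF assms(1) H(1) assms(4)]
      proper_BSF_inclusion_bounded[OF H(1) assms(2,5)] by blast
qed

theorem theorem6:
  fixes E F :: "('x \<Rightarrow> real) nspace"
  assumes "proper_BSF E" and "proper_BSF F"
    and "carrier E \<subseteq> carrier F" and "continuous_between E F id"
  shows "(two_factorable TYPE('x \<Rightarrow> real) E F id \<longleftrightarrow>
           (\<exists>H. RKHS H \<and> carrier E \<subseteq> carrier H \<and> carrier H \<subseteq> carrier F)) \<and>
         (two_factorable TYPE('h::real_vector) E F id \<longrightarrow>
           (\<exists>H. RKHS H \<and> carrier E \<subseteq> carrier H \<and> carrier H \<subseteq> carrier F)) \<and>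
         (\<forall>H. RKHS H \<and> carrier E \<subseteq> carrier H \<and> carrier H \<subseteq> carrier F \<longrightarrow>
           continuous_between E H id \<and> continuous_between H F id)"
proof (intro conjI iffI impI allI)
  show "\<exists>H. RKHS H \<and> carrier E \<subseteq> carrier H \<and> carrier H \<subseteq> carrier F"
    if "two_factorable TYPE('x \<Rightarrow> real) E F id"
    using two_factorable_imp_intermediate_RKHS[OF assms(2) that] .
  show "two_factorable TYPE('x \<Rightarrow> real) E F id"
    if "\<exists>H. RKHS H \<and> carrier E \<subseteq> carrier H \<and> carrier H \<subseteq> carrier F"
    using that intermediate_RKHS_imp_two_factorable[OF assms(1,2)] by blast
  show "\<exists>H. RKHS H \<and> carrier E \<subseteq> carrier H \<and> carrier H \<subseteq> carrier F"
    if "two_factorable TYPE('h) E F id"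
    using two_factorable_imp_intermediate_RKHS[OF assms(2) that] .
  fix H assume H: "RKHS H \<and> carrier E \<subseteq> carrier H \<and> carrier H \<subseteq> carrier F"
  then have "proper_BSF H" by (simp add: RKHS_def)
  with H show "continuous_between E H id" "continuous_between H F id"
    using proper_BSF_inclusion_continuous assms(1,2) by blast+
qed

end
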